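(* Let $X_1$ and $X_2$ be normed spaces, $Y_1\subset X_1^*$ and $Y_2\subset X_2^*$ subspaces and $\kappa$ an infinite cardinal. Let $P$ be one of the following properties: SD2P$_{<\kappa}$, 1-ASD2P$_{<\kappa}$ or ASD2P. The following are equivalent: (i) either $(X_1,Y_1)$ or $(X_2,Y_2)$ satisfies $P$; (ii) $(X_1\oplus_\infty X_2,\,Y_1\oplus_1Y_2)$ satisfies $P$.
   Context: Normed spaces are real and nonzero. $B_X$, $S_X$ denote the closed unit ball and unit sphere of $X$. "Either ... or" is inclusive. $X_1\oplus_\infty X_2$ is $X_1\times X_2$ with norm $\max\{\|x_1\|,\|x_2\|\}$; its dual is $X_1^*\oplus_1X_2^*$ (norm $\|x_1^*\|+\|x_2^*\|$) with $(x_1^*,x_2^* )(x_1,x_2)=x_1^*(x_1)+x_2^*(x_2)$, and $Y_1\oplus_1Y_2$ is regarded as a subspace of it. A slice of $B_X$ defined by $x^*\in S_{X^*}$ is a set $\{x\in B_X:x^*(x)\ge1-\varepsilon\}$ with $\varepsilon\in(0,1)$. For $B\subset X$, $A\subset X^*$ and $\lambda\in(0,1)$, $B$ $\lambda$-norms $A$ if for every $x^*\in A$ there is $x\in B\setminus\{0\}$ with $x^*(x)\ge\lambda\|x^*\|\|x\|$; $B$ norms $A$ if this holds for every $\lambda\in(0,1)$. For a subspace $Y\subset X^*$: - $(X,Y)$ has the SD2P$_{<\kappa}$ if for every $A\subset S_Y$ with $|A|<\kappa$ and every $\lambda\in(0,1)$ there are $B\subset S_X$ and $x^*\in S_{X^*}$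 such that $B$ $\lambda$-norms $A$ and $x^*(x)\ge\lambda$ for every $x\in B$; - $(X,Y)$ has the 1-ASD2P$_{<\kappa}$ if for every $A\subset S_Y$ with $|A|<\kappa$ there are $B\subset S_X$ and $x^*\in S_{X^*}$ such that $B$ norms $A$ and $x^*(x)=1$ for every $x\in B$; - $(X,Y)$ has the ASD2P if every finite convex combination $\sum_{i=1}^n\lambda_iS_i$ ($\lambda_i\ge 0$, $\sum_i\lambda_i=1$) of slices $S_i$ of $B_X$ defined by functionals in $Y$ intersects $S_X$. *)

theory Defs
  imports "HOL-Analysis.Analysis"
begin

unbundle cardinal_syntax

section \<open>The \<open>\<ell>\<^sub>\<infinity>\<close>-sum of two normed spaces\<close>

text \<open>The library norm on \<open>'a \<times> 'b\<close> is the Euclidean one, so the sum with the maximum norm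
  gets a type of its own.\<close>

datatype ('a, 'b) linf_sum = LPair (lfst: 'a) (lsnd: 'b)

instantiation linf_sum :: (real_normed_vector, real_normed_vector) real_normed_vector
begin

definition "0 = LPair 0 0"
definition "x + y = LPair (lfst x + lfst y) (lsnd x + lsnd y)"
definition "x - y = LPair (lfst x - lfst y) (lsnd x - lsnd y)"
definition "- x = LPair (- lfst x) (- lsnd x)"
definition "r *\<^sub>R x = LPair (r *\<^sub>R lfst x) (r *\<^sub>R lsnd x)"
definition "norm x = max (norm (lfst x)) (norm (lsnd x))"
definition "dist x y = norm (x - y)" for x y :: "('a, 'b) linf_sum"
definition "sgn x = inverse (norm x) *\<^sub>R x" for x :: "('a, 'b) linf_sum"
definition "(uniformity :: (('a, 'b) linf_sum \<times> ('a, 'b) linf_sum) filter)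
  = (INF e\<in>{0<..}. principal {(x, y). dist x y < e})"
definition "open U \<longleftrightarrow> (\<forall>x\<in>U. \<forall>\<^sub>F (x', y) in uniformity. x' = x \<longrightarrow> y \<in> U)"
  for U :: "('a, 'b) linf_sum set"

instance
proof
  fix x y z :: "('a, 'b) linf_sum" and a b :: real and U :: "('a, 'b) linf_sum set"
  note vec = zero_linf_sum_def plus_linf_sum_def minus_linf_sum_def uminus_linf_sum_def
    scaleR_linf_sum_def
  show "x + y + z = x + (y + z)" by (simp add: vec add.assoc)
  show "x + y = y + x" by (simp add: vec add.commute)
  show "0 + x = x" by (simp add: vec)
  show "- x + x = 0" by (simp add: vec)
  show "x - y = x + - y" by (simp add: vec)
  show "a *\<^sub>R (x + y) = a *\<^sub>R x + a *\<^sub>R y" by (simp add: vec scaleR_add_right)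
  show "(a + b) *\<^sub>R x = a *\<^sub>R x + b *\<^sub>R x" by (simp add: vec scaleR_add_left)
  show "a *\<^sub>R b *\<^sub>R x = (a * b) *\<^sub>R x" by (simp add: vec)
  show "1 *\<^sub>R x = x" by (simp add: vec)
  show "dist x y = norm (x - y)" by (rule dist_linf_sum_def)
  show "sgn x = inverse (norm x) *\<^sub>R x" by (rule sgn_linf_sum_def)
  show "uniformity = (INF e\<in>{0<..}. principal {(x, y::('a, 'b) linf_sum). dist x y < e})"
    by (rule uniformity_linf_sum_def)
  show "open U \<longleftrightarrow> (\<forall>x\<in>U. \<forall>\<^sub>F (x', y) in uniformity. x' = x \<longrightarrow> y \<in> U)"
    by (rule open_linf_sum_def)
  show "norm x = 0 \<longleftrightarrow> x = 0"
    by (cases x) (auto simp: norm_linf_sum_def vec max_def)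
  show "norm (x + y) \<le> norm x + norm y"
    using norm_triangle_ineq[of "lfst x" "lfst y"] norm_triangle_ineq[of "lsnd x" "lsnd y"]
    by (simp add: norm_linf_sum_def vec) linarith
  show "norm (a *\<^sub>R x) = \<bar>a\<bar> * norm x"
    by (simp add: norm_linf_sum_def vec max_mult_distrib_left)
qed

end

lemma lfst_simps [simp]:
  "lfst 0 = 0" "lfst (x + y) = lfst x + lfst y" "lfst (x - y) = lfst x - lfst y"
  "lfst (- x) = - lfst x" "lfst (r *\<^sub>R x) = r *\<^sub>R lfst x"
  by (simp_all add: zero_linf_sum_def plus_linf_sum_def minus_linf_sum_def
      uminus_linf_sum_def scaleR_linf_sum_def)

lemma lsnd_simps [simp]:
  "lsnd 0 = 0" "lsnd (x + y) = lsnd x + lsnd y" "lsnd (x - y) = lsnd x - lsnd y"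
  "lsnd (- x) = - lsnd x" "lsnd (r *\<^sub>R x) = r *\<^sub>R lsnd x"
  by (simp_all add: zero_linf_sum_def plus_linf_sum_def minus_linf_sum_def
      uminus_linf_sum_def scaleR_linf_sum_def)

lemma norm_LPair: "norm (LPair x y) = max (norm x) (norm y)"
  by (simp add: norm_linf_sum_def)

lemma bounded_linear_lfst: "bounded_linear lfst"
  by (rule bounded_linear_intro[where K = 1]) (simp_all add: norm_linf_sum_def)

lemma bounded_linear_lsnd: "bounded_linear lsnd"
  by (rule bounded_linear_intro[where K = 1]) (simp_all add: norm_linf_sum_def)


section \<open>Functionals on the sum\<close>

text \<open>The functional \<open>(f, g)\<close>, acting by \<open>(f, g) (x, y) = f x + g y\<close>.\<close>

definition dual_pair ::
  "('a::real_normed_vector \<Rightarrow>\<^sub>L real) \<Rightarrow> ('b::real_normed_vector \<Rightarrow>\<^sub>L real) \<Rightarrow> ('a, 'b) linf_sum \<Rightarrow>\<^sub>L real"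
  where "dual_pair f g = Blinfun (\<lambda>z. f (lfst z) + g (lsnd z))"

text \<open>\<open>Y\<^sub>1 \<oplus>\<^sub>1 Y\<^sub>2\<close> as a subset of the dual of the \<open>\<ell>\<^sub>\<infinity>\<close>-sum; lemma \<open>norm_dual_pair\<close> below shows
  that the dual norm restricts to the \<open>\<ell>\<^sub>1\<close>-norm.\<close>

definition l1_sum ::
  "('a::real_normed_vector \<Rightarrow>\<^sub>L real) set \<Rightarrow> ('b::real_normed_vector \<Rightarrow>\<^sub>L real) set
    \<Rightarrow> (('a, 'b) linf_sum \<Rightarrow>\<^sub>L real) set"
  where "l1_sum Y1 Y2 = {dual_pair f g | f g. f \<in> Y1 \<and> g \<in> Y2}"

lemma dual_pair_apply [simp]: "dual_pair f g z = f (lfst z) + g (lsnd z)"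
proof -
  have "bounded_linear (\<lambda>z. f (lfst z) + g (lsnd z))"
    by (intro bounded_linear_add bounded_linear_compose[OF blinfun.bounded_linear_right]
        bounded_linear_lfst bounded_linear_lsnd)
  then show ?thesis
    by (simp add: dual_pair_def bounded_linear_Blinfun_apply)
qed

lemma norm_dual_pair: "norm (dual_pair f g) = norm f + norm g"
proof (rule antisym)
  show "norm (dual_pair f g) \<le> norm f + norm g"
  proof (rule norm_blinfun_bound)
    fix z :: "('a, 'b) linf_sum"
    have "norm (f (lfst z)) \<le> norm f * norm z"
      by (rule order_trans[OF norm_blinfun]) (simp add: norm_linf_sum_def mult_left_mono)
    moreover have "norm (g (lsnd z)) \<le> norm g * norm z"
      by (rule order_trans[OF norm_blinfun]) (simp add: norm_linf_sum_def mult_left_mono)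
    ultimately show "norm (dual_pair f g z) \<le> (norm f + norm g) * norm z"
      using norm_triangle_ineq[of "f (lfst z)" "g (lsnd z)"]
      by (simp add: distrib_right)
  qed simp
next
  let ?N = "norm (dual_pair f g)"
  have unit: "f x + g y \<le> ?N" if "norm x \<le> 1" "norm y \<le> 1" for x y
  proof -
    have "f x + g y \<le> norm (dual_pair f g (LPair x y))" by simp
    also have "\<dots> \<le> ?N * norm (LPair x y)" by (rule norm_blinfun)
    also have "\<dots> \<le> ?N * 1" using that by (intro mult_left_mono) (auto simp: norm_LPair)
    finally show ?thesis by simp
  qed
  have bnd: "norm h \<le> c" if "\<And>x. norm x \<le> 1 \<Longrightarrow> h x \<le> c"
    for h :: "'c::real_normed_vector \<Rightarrow>\<^sub>L real" and c
  proof (rule norm_blinfun_bound)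
    show "0 \<le> c" using that[of 0] by simp
    fix x
    show "norm (h x) \<le> c * norm x"
    proof (cases "x = 0")
      case False
      have "h (sgn x) \<le> c" "h (- sgn x) \<le> c" by (auto intro!: that simp: norm_sgn)
      with False show ?thesis
        by (auto simp: sgn_div_norm blinfun.scaleR_right blinfun.minus_right divide_simps
            abs_le_iff)
    qed simp
  qed
  have "norm f \<le> ?N - g y" if "norm y \<le> 1" for y
    using unit[OF _ that] by (intro bnd) (simp add: le_diff_eq)
  then have "norm g \<le> ?N - norm f"
    by (intro bnd) (simp add: algebra_simps)
  then show "norm f + norm g \<le> ?N" by simp
qed

lemma dual_pair_surj: "\<exists>f g. h = dual_pair f g"
proof (intro exI)
  have l: "bounded_linear (\<lambda>x. LPair x 0)" "bounded_linear (\<lambda>y. LPair 0 y)"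
    by (rule bounded_linear_intro[where K = 1];
        simp add: norm_LPair plus_linf_sum_def scaleR_linf_sum_def)+
  show "h = dual_pair (h o\<^sub>L Blinfun (\<lambda>x. LPair x 0)) (h o\<^sub>L Blinfun (\<lambda>y. LPair 0 y))"
    by (rule blinfun_eqI)
      (simp add: l bounded_linear_Blinfun_apply blinfun.add_right[symmetric] plus_linf_sum_def)
qed


section \<open>Norming sets and diameter two properties\<close>

definition lam_norms ::
  "real \<Rightarrow> 'a::real_normed_vector set \<Rightarrow> ('a \<Rightarrow>\<^sub>L real) set \<Rightarrow> bool"
  where "lam_norms l B A \<longleftrightarrow> (\<forall>f\<in>A. \<exists>x\<in>B - {0}. blinfun_apply f x \<ge> l * norm f * norm x)"

definition norms :: "'a::real_normed_vector set \<Rightarrow> ('a \<Rightarrow>\<^sub>L real) set \<Rightarrow> bool"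
  where "norms B A \<longleftrightarrow> (\<forall>l\<in>{0<..<1}. lam_norms l B A)"

text \<open>In the three properties of a pair \<open>(X, Y)\<close> below, the space \<open>X\<close> is the type \<open>'a\<close>, and a
  cardinal is represented by a cardinal order \<open>\<kappa>\<close> on an arbitrary type.\<close>

definition SD2P_less :: "'k rel \<Rightarrow> ('a::real_normed_vector \<Rightarrow>\<^sub>L real) set \<Rightarrow> bool"
  where "SD2P_less \<kappa> Y \<longleftrightarrow>
    (\<forall>A \<subseteq> Y \<inter> sphere 0 1. |A| <o \<kappa> \<longrightarrow>
      (\<forall>l\<in>{0<..<1}. \<exists>B \<subseteq> sphere 0 1. \<exists>f\<in>sphere 0 1.
        lam_norms l B A \<and> (\<forall>x\<in>B. blinfun_apply f x \<ge> l)))"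

definition ASD2P1_less :: "'k rel \<Rightarrow> ('a::real_normed_vector \<Rightarrow>\<^sub>L real) set \<Rightarrow> bool"
  where "ASD2P1_less \<kappa> Y \<longleftrightarrow>
    (\<forall>A \<subseteq> Y \<inter> sphere 0 1. |A| <o \<kappa> \<longrightarrow>
      (\<exists>B \<subseteq> sphere 0 1. \<exists>f\<in>sphere 0 1. norms B A \<and> (\<forall>x\<in>B. blinfun_apply f x = (1::real))))"

definition slice :: "('a::real_normed_vector \<Rightarrow>\<^sub>L real) \<Rightarrow> real \<Rightarrow> 'a set"
  where "slice f e = {x \<in> cball 0 1. f x \<ge> 1 - e}"

definition slices_by :: "('a::real_normed_vector \<Rightarrow>\<^sub>L real) set \<Rightarrow> 'a set set"
  where "slices_by Y = {slice f e | f e. f \<in> Y \<inter> sphere 0 1 \<and> 0 < e \<and> e < 1}"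

definition set_combination :: "nat \<Rightarrow> (nat \<Rightarrow> real) \<Rightarrow> (nat \<Rightarrow> 'a::real_vector set) \<Rightarrow> 'a set"
  where "set_combination n c S = {\<Sum>i=1..n. c i *\<^sub>R x i | x. \<forall>i\<in>{1..n}. x i \<in> S i}"

definition ASD2P :: "('a::real_normed_vector \<Rightarrow>\<^sub>L real) set \<Rightarrow> bool"
  where "ASD2P Y \<longleftrightarrow>
    (\<forall>n c S. (\<forall>i\<in>{1..n}. c i \<ge> 0) \<and> (\<Sum>i=1..n. c i) = 1 \<and> (\<forall>i\<in>{1..n}. S i \<in> slices_by Y)
      \<longrightarrow> set_combination n c S \<inter> sphere 0 1 \<noteq> {})"

end

theory Submission
  imports Defs
begin

text \<open>If one summand has the property, its vectors and its functional do the work in the sum: from a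
family of functionals \<open>(f, g)\<close> of norm \<open>\<parallel>f\<parallel> + \<parallel>g\<parallel> = 1\<close> keep the normalised first components
\<open>sgn f\<close>, take what the property of the first summand provides for them, and complete every unit vector \<open>x\<close> so obtained to \<open>(x, y)\<close>
with \<open>\<parallel>y\<parallel> \<le> 1\<close>. In the maximum norm the completion stays on the sphere whatever \<open>y\<close> is, so \<open>y\<close>
can be chosen to make \<open>g y\<close> almost \<open>\<parallel>g\<parallel>\<close>, and the functional \<open>(x*, 0)\<close> takes the same values
as \<open>x*\<close> (\<open>SD2P_less_sum\<close>, \<open>ASD2P1_less_sum\<close>, \<open>ASD2P_sum\<close>). Pairs with \<open>f = 0\<close> impose nothing on
\<open>x\<close>, and one vector \<open>x\<close> has to be supplied for them; for the exact property it must
satisfy \<open>x* x = 1\<close>, which the Hahn-Banach theorem provides.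

Conversely, let both summands fail, with witnesses \<open>A\<^sub>1\<close> and \<open>A\<^sub>2\<close>. Test the sum on all pairs
\<open>(f/2, g/2)\<close> with \<open>f \<in> A\<^sub>1\<close> and \<open>g \<in> A\<^sub>2\<close>; there are fewer than \<open>\<kappa>\<close> of them since \<open>\<kappa>\<close> is infinite.
Because neither half can exceed \<open>1/2\<close>, a vector \<open>(x, y)\<close> that is almost norming for the pair is
almost norming for \<open>f\<close> and for \<open>g\<close>. The functional \<open>(x*, y*)\<close> found in the sum has
\<open>\<parallel>x*\<parallel> + \<parallel>y*\<parallel> = 1\<close>, so one of its components has norm at least \<open>1/2\<close>; being almost \<open>1\<close> on
\<open>(x, y)\<close>, it forces that component to be almost at its norm, and after normalisation the
corresponding summand has what its witness excludes (\<open>lam_norms_fst_dirs\<close>, \<open>large_on_fst_dirs\<close>).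
This argument needs both \<open>A\<^sub>1\<close> and \<open>A\<^sub>2\<close> to be nonempty, which again follows from Hahn-Banach: the
empty family is a witness of failure only if there is no functional of norm one.

For the ASD2P the witnesses are two convex combinations of slices, and the products \<open>c\<^sub>i d\<^sub>j\<close> of
their weights combine the slices given by \<open>(f\<^sub>i/2, g\<^sub>j/2)\<close>. Summing over \<open>j\<close> first, and using that
slices are convex, shows that the first coordinate of any element is in the first combination;
likewise for the second. These combinations miss the unit sphere by choice of the witnesses, so both
coordinates have norm less than \<open>1\<close>, and so has the element
(\<open>ASD2P_summand\<close>).\<close>

section \<open>Norming functionals\<close>

definition sublinear :: "('a::real_vector \<Rightarrow> real) \<Rightarrow> bool"
  where "sublinear p \<longleftrightarrow> (\<forall>x y. p (x + y) \<le> p x + p y) \<and> (\<forall>r>0. \<forall>x. p (r *\<^sub>R x) \<le> r * p x)"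

lemma sublinear_add: "sublinear p \<Longrightarrow> p (x + y) \<le> p x + p y"
  by (simp add: sublinear_def)

text \<open>The definition of \<open>sublinear\<close> only asks for one inequality and for positive factors, which is
the least that has to be verified for infima; homogeneity follows by applying the inequality to the
inverse factor as well.\<close>

lemma sublinear_scale:
  assumes "sublinear p" "0 \<le> r" shows "p (r *\<^sub>R x) = r * p x"
proof -
  have le: "p (s *\<^sub>R z) \<le> s * p z" if "0 < s" for s z
    using assms(1) that by (simp add: sublinear_def)
  show ?thesis
  proof (cases "r = 0")
    case True
    have "p 0 = 0"
      using sublinear_add[OF assms(1), of 0 0] le[of "1/2" 0] by simp
    with True show ?thesis by simp
  next
    case False
    with assms(2) have r: "0 < r" by simp
    have "p x \<le> inverse r * p (r *\<^sub>R x)"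
      using le[of "inverse r" "r *\<^sub>R x"] r by simp
    with le[OF r, of x] r show ?thesis by (simp add: field_simps)
  qed
qed

lemma sublinear_ge: "sublinear p \<Longrightarrow> - p (- x) \<le> p x"
  using sublinear_add[of p x "- x"] sublinear_scale[of p 0 0] by simp

lemma sublinear_norm: "sublinear (norm :: 'a::real_normed_vector \<Rightarrow> real)"
  by (simp add: sublinear_def norm_triangle_ineq)

text \<open>The functional \<open>x \<mapsto> inf {p (x + t y) - t p y | t \<ge> 0}\<close> is
sublinear; \<open>t = 0\<close> shows that it lies below \<open>p\<close>, and \<open>t = 1\<close> that it is at most \<open>- p y\<close> at \<open>- y\<close>.
A sublinear functional that cannot be decreased is therefore odd.\<close>

lemma sublinear_decrease:
  assumes p: "sublinear p"
  obtains q where "sublinear q" "q \<le> p" "q (- y) \<le> - p y"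
proof
  define q where "q x = (INF t\<in>{0..}. p (x + t *\<^sub>R y) - t * p y)" for x
  \<comment> \<open>The infima are finite, because \<open>t p y = p (t y) \<le> p (x + t y) + p (- x)\<close>.\<close>
  have "- p (- x) \<le> p (x + t *\<^sub>R y) - t * p y" if "0 \<le> t" for x t
    using sublinear_add[OF p, of "x + t *\<^sub>R y" "- x"] sublinear_scale[OF p that, of y] by simp
  then have "bdd_below ((\<lambda>t. p (x + t *\<^sub>R y) - t * p y) ` {0..})" for x
    by (intro bdd_belowI2) auto
  then have lower: "q x \<le> p (x + t *\<^sub>R y) - t * p y" if "0 \<le> t" for x t
    unfolding q_def using that by (intro cINF_lower) auto
  have greatest: "c \<le> q x" if "\<And>t. 0 \<le> t \<Longrightarrow> c \<le> p (x + t *\<^sub>R y) - t * p y" for c x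
    unfolding q_def using that by (intro cINF_greatest) auto
  show "sublinear q"
    unfolding sublinear_def
  proof (intro conjI allI impI)
    fix x x'
    have "q (x + x') - (p (x' + s *\<^sub>R y) - s * p y) \<le> p (x + t *\<^sub>R y) - t * p y"
      if "0 \<le> t" "0 \<le> s" for t s
      using lower[of "t + s" "x + x'"] that
        sublinear_add[OF p, of "x + t *\<^sub>R y" "x' + s *\<^sub>R y"]
      by (simp add: algebra_simps)
    then have "q (x + x') - (p (x' + s *\<^sub>R y) - s * p y) \<le> q x" if "0 \<le> s" for s
      using that by (intro greatest)
    then have "q (x + x') - q x \<le> p (x' + s *\<^sub>R y) - s * p y" if "0 \<le> s" for s
      using that by (simp add: algebra_simps)
    then have "q (x + x') - q x \<le> q x'"
      by (intro greatest)
    then show "q (x + x') \<le> q x + q x'" by simp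
  next
    fix r :: real and x assume r: "0 < r"
    have "q (r *\<^sub>R x) / r \<le> p (x + t *\<^sub>R y) - t * p y" if "0 \<le> t" for t
      using lower[of "r * t" "r *\<^sub>R x"] that r sublinear_scale[OF p, of r "x + t *\<^sub>R y"]
      by (simp add: field_simps scaleR_add_right)
    then have "q (r *\<^sub>R x) / r \<le> q x" by (rule greatest)
    with r show "q (r *\<^sub>R x) \<le> r * q x" by (simp add: field_simps)
  qed
  show "q \<le> p"
    using lower[of 0] by (simp add: le_fun_def)
  show "q (- y) \<le> - p y"
    using lower[of 1 "- y"] sublinear_scale[OF p, of 0 0] by simp
qed

text \<open>The Hahn-Banach theorem: Zorn's lemma gives a minimal sublinear functional below \<open>p\<close>, which is
odd by \<open>sublinear_decrease\<close>, and an odd sublinear functional is linear. Lower bounds of chains are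
pointwise infima: to compare their values at \<open>x\<close> and \<open>y\<close> with members \<open>q\<close> and \<open>r\<close> of the chain,
the smaller of \<open>q\<close> and \<open>r\<close> serves for both.\<close>

lemma ex_linear_below_sublinear:
  fixes p :: "'a::real_vector \<Rightarrow> real"
  assumes p: "sublinear p"
  obtains f where "linear f" "f \<le> p"
proof -
  define A where "A = {q. sublinear q \<and> q \<le> p}"
  have "\<exists>m\<in>A. \<forall>q\<in>A. q \<le> m \<longrightarrow> q = m"
  proof (rule predicate_Zorn)
    show "partial_order_on A (relation_of (\<lambda>q r. r \<le> q) A)"
      by (rule partial_order_on_relation_ofI) auto
  next
    fix C assume C: "C \<in> Chains (relation_of (\<lambda>q r. r \<le> q) A)"
    then have CA: "C \<subseteq> A" by (rule Chains_relation_of)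
    have chain: "q \<le> r \<or> r \<le> q" if "q \<in> C" "r \<in> C" for q r
      using C that by (auto simp: Chains_def relation_of_def)
    show "\<exists>u\<in>A. \<forall>q\<in>C. u \<le> q"
    proof (cases "C = {}")
      case True
      then show ?thesis using p by (auto simp: A_def)
    next
      case False
      define u where "u x = (INF q\<in>C. q x)" for x
      have "- p (- x) \<le> q x" if "q \<in> C" for q x
      proof -
        have "q (- x) \<le> p (- x)" "sublinear q"
          using that CA by (auto simp: A_def le_fun_def)
        then show ?thesis using sublinear_ge[of q x] by simp
      qed
      then have "bdd_below ((\<lambda>q. q x) ` C)" for x
        by (intro bdd_belowI2)
      then have lower: "u x \<le> q x" if "q \<in> C" for q x
        unfolding u_def using that by (intro cINF_lower)
      have greatest: "c \<le> u x" if "\<And>q. q \<in> C \<Longrightarrow> c \<le> q x" for c x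
        unfolding u_def using that False by (intro cINF_greatest)
      have "u (x + y) - r y \<le> q x" if qr: "q \<in> C" "r \<in> C" for q r x y
      proof -
        obtain s where s: "s \<in> C" "s \<le> q" "s \<le> r"
          using chain[OF qr] qr by blast
        have "u (x + y) \<le> s x + s y"
          using lower[OF s(1), of "x + y"] s(1) CA sublinear_add[of s x y] by (auto simp: A_def)
        also have "\<dots> \<le> q x + r y" using s by (auto simp: le_fun_def intro: add_mono)
        finally show ?thesis by simp
      qed
      then have "u (x + y) - r y \<le> u x" if "r \<in> C" for r x y
        using that by (intro greatest)
      then have "u (x + y) - u x \<le> r y" if "r \<in> C" for r x y
        using that by (simp add: algebra_simps)
      then have "u (x + y) - u x \<le> u y" for x y
        by (intro greatest)
      moreover have "u (r *\<^sub>R x) / r \<le> u x" if "0 < r" for r x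
      proof (rule greatest)
        fix q assume q: "q \<in> C"
        then have "sublinear q" using CA by (auto simp: A_def)
        then show "u (r *\<^sub>R x) / r \<le> q x"
          using lower[OF q, of "r *\<^sub>R x"] sublinear_scale[of q r x] that by (simp add: field_simps)
      qed
      ultimately have "sublinear u"
        by (simp add: sublinear_def field_simps)
      moreover have "u \<le> p"
      proof -
        obtain q where "q \<in> C" "q \<le> p" using False CA by (auto simp: A_def)
        then show ?thesis using lower by (meson le_funD le_funI order_trans)
      qed
      ultimately show ?thesis
        using lower by (auto simp: A_def le_fun_def)
    qed
  qed
  then obtain m where m: "sublinear m" "m \<le> p" and min: "\<And>q. sublinear q \<Longrightarrow> q \<le> m \<Longrightarrow> q = m"
    unfolding A_def by (metis (mono_tags, lifting) mem_Collect_eq order_trans)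
  have odd: "m (- y) = - m y" for y
  proof -
    obtain q where "sublinear q" "q \<le> m" "q (- y) \<le> - m y"
      using sublinear_decrease[OF m(1)] .
    with min have "m (- y) \<le> - m y" by metis
    with sublinear_ge[OF m(1), of y] show ?thesis by simp
  qed
  have "linear m"
  proof (rule linearI)
    show "m (x + y) = m x + m y" for x y
      using sublinear_add[OF m(1), of x y] sublinear_add[OF m(1), of "x + y" "- y"] odd[of y] by simp
    show "m (r *\<^sub>R x) = r *\<^sub>R m x" for r x
    proof (cases "0 \<le> r")
      case True
      then show ?thesis using sublinear_scale[OF m(1)] by simp
    next
      case False
      then show ?thesis
        using sublinear_scale[OF m(1), of "- r" x] odd[of "(- r) *\<^sub>R x"] by simp
    qed
  qed
  with m(2) that show ?thesis by blast
qed

text \<open>Decreasing the norm in direction \<open>x\<close> first, before taking a linear functional below it, makes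
that functional at most \<open>- \<parallel>x\<parallel>\<close> at \<open>- x\<close>, hence norming at \<open>x\<close>.\<close>

lemma ex_norming_functional:
  fixes x :: "'a::real_normed_vector"
  assumes "norm x = 1"
  obtains f :: "'a \<Rightarrow>\<^sub>L real" where "norm f = 1" "f x = 1"
proof -
  obtain q :: "'a \<Rightarrow> real" where q: "sublinear q" "q \<le> norm" "q (- x) \<le> - norm x"
    using sublinear_decrease[OF sublinear_norm] .
  obtain h where h: "linear h" "h \<le> q"
    using ex_linear_below_sublinear[OF q(1)] .
  have le: "h z \<le> norm z" for z
    using h(2) q(2) by (meson le_funD order_trans)
  have abs: "\<bar>h z\<bar> \<le> norm z" for z
    using le[of z] le[of "- z"] linear_neg[OF h(1), of z] by simp
  have "bounded_linear h"
    by (rule bounded_linear_intro[where K = 1])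
      (use h(1) abs in \<open>simp_all add: linear_add linear_scale\<close>)
  then have app: "blinfun_apply (Blinfun h) z = h z" for z
    by (simp add: bounded_linear_Blinfun_apply)
  have "1 \<le> h x"
    using le_funD[OF h(2), of "- x"] q(3) assms linear_neg[OF h(1), of x] by simp
  then have hx: "h x = 1" using le[of x] assms by simp
  have "norm (Blinfun h) \<le> 1"
    by (rule norm_blinfun_bound) (use abs in \<open>simp_all add: app\<close>)
  moreover have "1 \<le> norm (Blinfun h)"
    using norm_blinfun[of "Blinfun h" x] hx assms by (simp add: app)
  ultimately show ?thesis
    using that[of "Blinfun h"] hx by (simp add: app)
qed

lemma ex_unit_vector:
  assumes "(UNIV :: 'a::real_normed_vector set) \<noteq> {0}"
  obtains x :: "'a::real_normed_vector" where "norm x = 1"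
proof -
  obtain x :: 'a where "x \<noteq> 0" using assms by auto
  then show ?thesis using that[of "sgn x"] by (simp add: norm_sgn)
qed

lemma ex_almost_norming_vector:
  fixes f :: "'a::real_normed_vector \<Rightarrow>\<^sub>L real"
  assumes "(UNIV :: 'a set) \<noteq> {0}" and l: "l < 1"
  obtains x where "norm x = 1" "l * norm f \<le> f x"
proof (cases "f = 0")
  case True
  obtain x :: 'a where "norm x = 1" using ex_unit_vector[OF assms(1)] .
  with True that show ?thesis by simp
next
  case False
  have "\<exists>x. norm x = 1 \<and> l * norm f \<le> f x"
  proof (rule ccontr)
    assume "\<not> ?thesis"
    then have less: "f x < l * norm f" if "norm x = 1" for x using that by force
    have "norm f \<le> max 0 l * norm f"
    proof (rule norm_blinfun_bound)
      fix x
      show "norm (f x) \<le> max 0 l * norm f * norm x"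
      proof (cases "x = 0")
        case x: False
        have "f (sgn x) \<le> max 0 l * norm f" "f (- sgn x) \<le> max 0 l * norm f"
          using less[of "sgn x"] less[of "- sgn x"] x
            mult_right_mono[of l "max 0 l" "norm f"] by (auto simp: norm_sgn)
        with x show ?thesis
          by (auto simp: sgn_div_norm blinfun.scaleR_right blinfun.minus_right field_simps
              abs_le_iff)
      qed simp
    qed simp
    then have "1 \<le> max 0 l" using False by simp
    with l show False by simp
  qed
  with that show ?thesis by blast
qed

section \<open>Auxiliary facts on cardinals and norming sets\<close>

text \<open>The disjoint sum has cardinality below \<open>\<kappa>\<close> and, if infinite, bounds the product: this avoids
comparing the cardinalities of the two factors.\<close>

lemma card_of_Times_ordLess:
  assumes \<kappa>: "Card_order \<kappa>" "infinite (Field \<kappa>)"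
    and A: "|A| <o \<kappa>" and B: "|B| <o \<kappa>"
  shows "|A \<times> B| <o \<kappa>"
proof (cases "finite (A <+> B)")
  case True
  then have "finite (A \<times> B)"
    by (simp add: finite_Plus_iff)
  then show ?thesis
    using \<kappa> card_of_Well_order card_order_on_well_order_on
    by (intro finite_ordLess_infinite) (auto simp: Field_card_of)
next
  case False
  then have "|A \<times> B| \<le>o |A <+> B|"
    using card_of_Plus1 card_of_Plus2 card_of_Card_order
    by (intro card_of_Times_ordLeq_infinite_Field) (simp_all only: Field_card_of not_False_eq_True)
  moreover have "|A <+> B| <o \<kappa>"
    using \<kappa> A B by (intro card_of_Plus_ordLess_infinite_Field)
  ultimately show ?thesis
    by (rule ordLeq_ordLess_trans)
qed

lemma sgn_blinfun_apply: "sgn f x = f x / norm f" for f :: "'a::real_normed_vector \<Rightarrow>\<^sub>L real"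
  by (simp add: sgn_div_norm blinfun.scaleR_left divide_inverse mult.commute)

lemma sgn_in_subspace: "subspace Y \<Longrightarrow> f \<in> Y \<Longrightarrow> sgn f \<in> Y" for f :: "'a::real_normed_vector"
  by (simp add: sgn_div_norm subspace_scale)

lemma blinfun_le_norm:
  fixes f :: "'a::real_normed_vector \<Rightarrow>\<^sub>L real"
  assumes "norm x \<le> 1" shows "f x \<le> norm f"
  using norm_blinfun[of f x] mult_left_mono[OF assms norm_ge_zero[of f]] by simp

lemma lam_norms_sphere:
  fixes B :: "'a::real_normed_vector set"
  assumes "B \<subseteq> sphere 0 1"
  shows "lam_norms l B A \<longleftrightarrow> (\<forall>f\<in>A. \<exists>x\<in>B. l * norm f \<le> blinfun_apply f x)"
proof -
  have "x \<noteq> 0 \<and> norm x = 1" if "x \<in> B" for x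
    using assms that by auto
  then show ?thesis
    unfolding lam_norms_def by (intro ball_cong refl) fastforce
qed

section \<open>Decompositions with the maximum norm\<close>

text \<open>A space decomposed into two summands with the maximum norm, and its functionals decomposed
accordingly. Keeping the map \<open>J\<close> abstract lets every argument about the first summand be used for
the second one, with the arguments of \<open>J\<close> and \<open>D\<close> exchanged.\<close>

locale linf_decomposition =
  fixes J :: "'a::real_normed_vector \<Rightarrow> 'b::real_normed_vector \<Rightarrow> 'c::real_normed_vector"
    and D :: "('a \<Rightarrow>\<^sub>L real) \<Rightarrow> ('b \<Rightarrow>\<^sub>L real) \<Rightarrow> ('c \<Rightarrow>\<^sub>L real)"
  assumes nontrivial1: "(UNIV :: 'a set) \<noteq> {0}" and nontrivial2: "(UNIV :: 'b set) \<noteq> {0}"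
    and J_add: "J (x + x') (y + y') = J x y + J x' y'"
    and J_scaleR: "J (r *\<^sub>R x) (r *\<^sub>R y) = r *\<^sub>R J x y"
    and norm_J: "norm (J x y) = max (norm x) (norm y)"
    and J_surj: "\<exists>x y. z = J x y"
    and D_J [simp]: "D f g (J x y) = f x + g y"
    and norm_D: "norm (D f g) = norm f + norm g"
begin

lemma J_sum: "J (\<Sum>i\<in>I. c i *\<^sub>R x i) (\<Sum>i\<in>I. c i *\<^sub>R y i) = (\<Sum>i\<in>I. c i *\<^sub>R J (x i) (y i))"
proof -
  have "J 0 0 = 0" using J_scaleR[of 0 0 0] by simp
  then show ?thesis
    by (induction I rule: infinite_finite_induct) (simp_all add: J_add J_scaleR)
qed

definition Dsum :: "('a \<Rightarrow>\<^sub>L real) set \<Rightarrow> ('b \<Rightarrow>\<^sub>L real) set \<Rightarrow> ('c \<Rightarrow>\<^sub>L real) set"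
  where "Dsum Y1 Y2 = {D f g | f g. f \<in> Y1 \<and> g \<in> Y2}"

definition cylinder :: "'a set \<Rightarrow> 'c set"
  where "cylinder B = {J x y | x y. x \<in> B \<and> norm y \<le> 1}"

lemma cylinderI: "x \<in> B \<Longrightarrow> norm y \<le> 1 \<Longrightarrow> J x y \<in> cylinder B"
  unfolding cylinder_def by blast

lemma cylinder_subset_sphere: "B \<subseteq> sphere 0 1 \<Longrightarrow> cylinder B \<subseteq> sphere 0 1"
  by (auto simp: cylinder_def norm_J subset_iff)

text \<open>Since the second component of a vector in the cylinder is free, it can be chosen for each
functional \<open>D f g\<close> separately; the two estimates add up because the norm of \<open>D f g\<close> is the sum of
the norms. Nonemptiness of \<open>B\<close> takes care of the functionals with \<open>f = 0\<close>.\<close>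

lemma lam_norms_cylinder:
  assumes B: "B \<subseteq> sphere 0 1" "B \<noteq> {}" and l: "l < 1"
    and norms: "lam_norms l B A1"
    and A: "\<And>h. h \<in> A \<Longrightarrow> \<exists>f g. h = D f g \<and> (f = 0 \<or> sgn f \<in> A1)"
  shows "lam_norms l (cylinder B) A"
  unfolding lam_norms_sphere[OF cylinder_subset_sphere[OF B(1)]]
proof
  fix h assume "h \<in> A"
  then obtain f g where h: "h = D f g" and f: "f = 0 \<or> sgn f \<in> A1"
    using A by blast
  have "\<exists>x\<in>B. l * norm f \<le> f x"
  proof (cases "f = 0")
    case True
    with B(2) show ?thesis by auto
  next
    case False
    with f norms have "\<exists>x\<in>B. l * norm (sgn f) \<le> sgn f x"
      by (auto simp: lam_norms_sphere[OF B(1)])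
    with False show ?thesis
      by (simp add: norm_sgn sgn_blinfun_apply field_simps)
  qed
  then obtain x where x: "x \<in> B" "l * norm f \<le> f x" ..
  obtain y where y: "norm y = 1" "l * norm g \<le> g y"
    using ex_almost_norming_vector[OF nontrivial2 l] .
  show "\<exists>z\<in>cylinder B. l * norm h \<le> h z"
  proof
    show "J x y \<in> cylinder B" using x y by (simp add: cylinderI)
    show "l * norm h \<le> h (J x y)" using x y by (simp add: h norm_D distrib_left)
  qed
qed

text \<open>The functionals of the first summand that have to be normed in order to norm \<open>A\<close>. Zero first
components cannot be normalised and are left out.\<close>

lemma first_components:
  assumes "subspace Y1" and A: "A \<subseteq> Dsum Y1 Y2 \<inter> sphere 0 1" and card: "|A| <o \<kappa>"
  obtains A1 where "A1 \<subseteq> Y1 \<inter> sphere 0 1" "|A1| <o \<kappa>"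
    "\<And>h. h \<in> A \<Longrightarrow> \<exists>f g. h = D f g \<and> (f = 0 \<or> sgn f \<in> A1)"
proof -
  have "\<forall>h\<in>A. \<exists>f g. f \<in> Y1 \<and> h = D f g"
    using A unfolding Dsum_def by blast
  then obtain F G where FG: "\<And>h. h \<in> A \<Longrightarrow> F h \<in> Y1 \<and> h = D (F h) (G h)"
    by metis
  define A1 where "A1 = (\<lambda>h. sgn (F h)) ` A - {0}"
  show ?thesis
  proof
    show "A1 \<subseteq> Y1 \<inter> sphere 0 1"
    proof
      fix k assume "k \<in> A1"
      then obtain h where "h \<in> A" "k = sgn (F h)" "F h \<noteq> 0"
        by (auto simp: A1_def sgn_zero_iff)
      with FG[OF \<open>h \<in> A\<close>] assms(1) show "k \<in> Y1 \<inter> sphere 0 1"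
        by (simp add: sgn_in_subspace norm_sgn)
    qed
    have "|A1| \<le>o |(\<lambda>h. sgn (F h)) ` A|"
      by (rule card_of_mono1) (auto simp: A1_def)
    then show "|A1| <o \<kappa>"
      by (rule ordLeq_ordLess_trans[OF ordLeq_transitive[OF _ card_of_image] card])
    show "\<exists>f g. h = D f g \<and> (f = 0 \<or> sgn f \<in> A1)" if "h \<in> A" for h
    proof -
      have "F h = 0 \<or> sgn (F h) \<in> A1"
        using that by (auto simp: A1_def sgn_zero_iff)
      then show ?thesis using FG[OF that] by blast
    qed
  qed
qed

section \<open>From a summand to the sum\<close>

lemma SD2P_less_sum:
  assumes "subspace Y1" and P: "SD2P_less \<kappa> Y1"
  shows "SD2P_less \<kappa> (Dsum Y1 Y2)"
  unfolding SD2P_less_def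
proof (intro allI impI ballI)
  fix A :: "('c \<Rightarrow>\<^sub>L real) set" and l :: real
  assume A: "A \<subseteq> Dsum Y1 Y2 \<inter> sphere 0 1" "|A| <o \<kappa>" and l: "l \<in> {0<..<1}"
  obtain A1 where A1: "A1 \<subseteq> Y1 \<inter> sphere 0 1" "|A1| <o \<kappa>"
    and AA1: "\<And>h. h \<in> A \<Longrightarrow> \<exists>f g. h = D f g \<and> (f = 0 \<or> sgn f \<in> A1)"
    using first_components[OF assms(1) A] by blast
  obtain B0 and k :: "'a \<Rightarrow>\<^sub>L real" where B0: "B0 \<subseteq> sphere 0 1" "lam_norms l B0 A1" "\<forall>x\<in>B0. l \<le> k x"
    and k: "k \<in> sphere 0 1"
    using P[unfolded SD2P_less_def, rule_format, OF A1 l] by blast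
  \<comment> \<open>\<open>B0\<close> can be empty, so it is enlarged to all vectors at which \<open>k\<close> is large: as \<open>l < 1\<close>,
     there are such vectors.\<close>
  define B where "B = {x \<in> sphere 0 1. l \<le> k x}"
  have B: "B \<subseteq> sphere 0 1" "B0 \<subseteq> B"
    using B0 by (auto simp: B_def)
  obtain x where "norm x = 1" "l * norm k \<le> k x"
    using ex_almost_norming_vector[OF nontrivial1, of l k] l by auto
  with k have "B \<noteq> {}" by (auto simp: B_def)
  moreover have "lam_norms l B A1"
    using B0(2) B(2) unfolding lam_norms_def by blast
  ultimately have "lam_norms l (cylinder B) A"
    using l by (intro lam_norms_cylinder[OF B(1) _ _ _ AA1]) simp_all
  moreover have "\<forall>z\<in>cylinder B. l \<le> D k 0 z"
    by (auto simp: cylinder_def B_def)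
  moreover have "D k 0 \<in> sphere 0 1"
    using k by (simp add: norm_D)
  ultimately show "\<exists>B\<subseteq>sphere 0 1. \<exists>f\<in>sphere 0 1. lam_norms l B A \<and> (\<forall>x\<in>B. l \<le> blinfun_apply f x)"
    using cylinder_subset_sphere[OF B(1)]
    by (intro exI[of _ "cylinder B"] conjI bexI[of _ "D k 0"]) simp_all
qed

text \<open>Here the functional given by the property may not attain its norm, so if \<open>A1\<close> is empty it is
replaced by one that does.\<close>

lemma ASD2P1_less_sum:
  assumes "subspace Y1" and P: "ASD2P1_less \<kappa> Y1"
  shows "ASD2P1_less \<kappa> (Dsum Y1 Y2)"
  unfolding ASD2P1_less_def
proof (intro allI impI)
  fix A :: "('c \<Rightarrow>\<^sub>L real) set"
  assume A: "A \<subseteq> Dsum Y1 Y2 \<inter> sphere 0 1" "|A| <o \<kappa>"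
  obtain A1 where A1: "A1 \<subseteq> Y1 \<inter> sphere 0 1" "|A1| <o \<kappa>"
    and AA1: "\<And>h. h \<in> A \<Longrightarrow> \<exists>f g. h = D f g \<and> (f = 0 \<or> sgn f \<in> A1)"
    using first_components[OF assms(1) A] by blast
  obtain B and k :: "'a \<Rightarrow>\<^sub>L real" where B: "B \<subseteq> sphere 0 1" "B \<noteq> {}" "norms B A1" "\<forall>x\<in>B. k x = 1"
    and k: "norm k = 1"
  proof (cases "A1 = {}")
    case True
    obtain x :: 'a where x: "norm x = 1"
      using ex_unit_vector[OF nontrivial1] .
    moreover obtain k :: "'a \<Rightarrow>\<^sub>L real" where "norm k = 1" "k x = 1"
      using ex_norming_functional[OF x] .
    ultimately show ?thesis
      using that[of "{x}" k] True by (simp add: norms_def lam_norms_def)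
  next
    case False
    obtain B and k :: "'a \<Rightarrow>\<^sub>L real" where B: "B \<subseteq> sphere 0 1" "norms B A1" "\<forall>x\<in>B. k x = 1" and k: "k \<in> sphere 0 1"
      using P[unfolded ASD2P1_less_def, rule_format, OF A1] by blast
    have "lam_norms (1/2) B A1"
      using B(2) by (simp add: norms_def)
    with False have "B \<noteq> {}"
      by (auto simp: lam_norms_def)
    with B k that[of B k] show ?thesis by simp
  qed
  have "norms (cylinder B) A"
    unfolding norms_def
  proof
    fix l :: real assume "l \<in> {0<..<1}"
    then show "lam_norms l (cylinder B) A"
      using B(3) by (intro lam_norms_cylinder[OF B(1,2) _ _ AA1]) (simp_all add: norms_def)
  qed
  moreover have "\<forall>z\<in>cylinder B. D k 0 z = 1"
    using B(4) by (auto simp: cylinder_def)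
  moreover have "D k 0 \<in> sphere 0 1"
    using k by (simp add: norm_D)
  ultimately show "\<exists>B\<subseteq>sphere 0 1. \<exists>f\<in>sphere 0 1. norms B A \<and> (\<forall>x\<in>B. blinfun_apply f x = (1::real))"
    using cylinder_subset_sphere[OF B(1)]
    by (intro exI[of _ "cylinder B"] conjI bexI[of _ "D k 0"]) simp_all
qed

section \<open>From the sum to a summand: norming sets\<close>

text \<open>First components of vectors of the unit sphere can be shorter than \<open>1\<close>. Lower bounds by positive
numbers only improve when they are normalised.\<close>

definition fst_dirs :: "'c set \<Rightarrow> 'a set"
  where "fst_dirs B = {sgn x | x y. x \<noteq> 0 \<and> J x y \<in> B}"

lemma fst_dirs_subset_sphere: "fst_dirs B \<subseteq> sphere 0 1"
  by (auto simp: fst_dirs_def norm_sgn)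

text \<open>From \<open>f x / 2 + g y / 2 \<ge> (1 + l) / 2\<close> and \<open>g y \<le> 1\<close> one gets \<open>f x \<ge> l\<close>.\<close>

lemma lam_norms_fst_dirs:
  assumes l: "0 < l" and B: "B \<subseteq> sphere 0 1"
    and norms: "lam_norms ((1 + l) / 2) B A" and A: "A \<subseteq> sphere 0 1"
    and A1: "A1 \<subseteq> sphere 0 1"
    and half: "\<And>f. f \<in> A1 \<Longrightarrow> \<exists>g. norm g \<le> 1 \<and> D ((1/2) *\<^sub>R f) ((1/2) *\<^sub>R g) \<in> A"
  shows "lam_norms l (fst_dirs B) A1"
  unfolding lam_norms_sphere[OF fst_dirs_subset_sphere]
proof
  fix f assume f: "f \<in> A1"
  then obtain g where g: "norm g \<le> 1" "D ((1/2) *\<^sub>R f) ((1/2) *\<^sub>R g) \<in> A"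
    using half by blast
  obtain z where z: "z \<in> B" "(1 + l) / 2 \<le> D ((1/2) *\<^sub>R f) ((1/2) *\<^sub>R g) z"
    using norms g(2) A by (fastforce simp: lam_norms_sphere[OF B])
  obtain x y where xy: "z = J x y"
    using J_surj by blast
  have le: "norm x \<le> 1" "norm y \<le> 1"
    using z(1) B xy by (auto simp: norm_J subset_iff)
  have "g y \<le> 1"
    using blinfun_le_norm[OF le(2), of g] g(1) by simp
  with z(2) have fx: "l \<le> f x"
    by (simp add: xy blinfun.scaleR_left)
  with l have "x \<noteq> 0" by auto
  with fx l le have "l \<le> f (sgn x)"
    by (simp add: sgn_div_norm blinfun.scaleR_right field_simps)
      (meson mult_left_le order_trans less_imp_le)
  moreover have "sgn x \<in> fst_dirs B"
    using z(1) \<open>x \<noteq> 0\<close> xy by (auto simp: fst_dirs_def)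
  ultimately show "\<exists>x\<in>fst_dirs B. l * norm f \<le> f x"
    using A1 f by (auto simp: subset_iff)
qed

text \<open>On \<open>B\<close> the component \<open>g\<close> contributes at most \<open>\<parallel>g\<parallel> = 1 - \<parallel>f\<parallel>\<close>, so \<open>f\<close> is short of its norm by
at most \<open>(1 - l) / 2\<close>. Relative to \<open>\<parallel>f\<parallel> \<ge> 1/2\<close> this deficit is at most \<open>1 - l\<close>.\<close>

lemma large_on_fst_dirs:
  assumes l: "0 < l" "l \<le> 1" and B: "B \<subseteq> sphere 0 1"
    and D: "norm (D f g) = 1" "1 / 2 \<le> norm f" "\<forall>z\<in>B. (1 + l) / 2 \<le> D f g z"
    and x: "x \<in> fst_dirs B"
  shows "l \<le> sgn f x"
proof -
  obtain u y where u: "x = sgn u" "u \<noteq> 0" "J u y \<in> B"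
    using x by (auto simp: fst_dirs_def)
  have le: "norm u \<le> 1" "norm y \<le> 1"
    using u(3) B by (auto simp: norm_J subset_iff)
  have 1: "(1 + l) / 2 \<le> f u + g y"
    using D(3) u(3) by fastforce
  have 2: "g y \<le> 1 - norm f"
    using blinfun_le_norm[OF le(2), of g] D(1) by (simp add: norm_D)
  have "(1 - l) * (1 / 2) \<le> (1 - l) * norm f"
    using l D(2) by (intro mult_left_mono) auto
  then have "(1 - l) / 2 \<le> norm f - l * norm f"
    by (simp add: left_diff_distrib)
  with 1 2 have "l * norm f \<le> f u"
    by (simp add: field_simps)
  moreover have "l * norm f * norm u \<le> l * norm f"
    using l le by (simp add: mult_left_le)
  moreover have "norm f > 0" using D(2) by linarith
  moreover have "sgn f x = f u / (norm f * norm u)"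
    by (simp add: u(1) sgn_blinfun_apply sgn_div_norm[of u] blinfun.scaleR_right divide_inverse)
  ultimately show ?thesis
    using u(2) by (simp add: pos_le_divide_eq mult.assoc)
qed

lemma norms_fst_dirs:
  assumes "B \<subseteq> sphere 0 1" "norms B A" "A \<subseteq> sphere 0 1" "A1 \<subseteq> sphere 0 1"
    and "\<And>f. f \<in> A1 \<Longrightarrow> \<exists>g. norm g \<le> 1 \<and> D ((1/2) *\<^sub>R f) ((1/2) *\<^sub>R g) \<in> A"
  shows "norms (fst_dirs B) A1"
  unfolding norms_def
proof
  fix l :: real assume l: "l \<in> {0<..<1}"
  then have "0 < l" "lam_norms ((1 + l) / 2) B A"
    using assms(2) by (simp_all add: norms_def)
  then show "lam_norms l (fst_dirs B) A1"
    using assms(1,3,4,5) by (intro lam_norms_fst_dirs) simp_all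
qed

lemma one_on_fst_dirs:
  assumes B: "B \<subseteq> sphere 0 1"
    and D: "norm (D f g) = 1" "1 / 2 \<le> norm f" "\<forall>z\<in>B. D f g z = 1"
    and x: "x \<in> fst_dirs B"
  shows "sgn f x = 1"
proof (rule antisym)
  have "norm (sgn f) = 1" using D(2) by (auto simp: norm_sgn)
  moreover have "norm x \<le> 1" using x fst_dirs_subset_sphere[of B] by (auto simp: subset_iff)
  ultimately show "sgn f x \<le> 1" using blinfun_le_norm[of x "sgn f"] by simp
  show "1 \<le> sgn f x"
    using D by (intro large_on_fst_dirs[OF _ _ B _ _ _ x, where g = g]) simp_all
qed

end

section \<open>Convex combinations of slices\<close>

lemma slice_iff: "x \<in> slice f e \<longleftrightarrow> norm x \<le> 1 \<and> 1 - e \<le> f x"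
  by (simp add: slice_def)

lemma convex_slice: "convex (slice f e)"
proof -
  have "slice f e = cball 0 1 \<inter> f -` {1 - e..}"
    by (auto simp: slice_def)
  then show ?thesis
    by (simp add: convex_Int convex_linear_vimage blinfun.bounded_linear_right
        bounded_linear.linear)
qed

lemma ASD2P_I:
  fixes Y :: "('a::real_normed_vector \<Rightarrow>\<^sub>L real) set"
  assumes "\<And>(n::nat) c f e. (\<And>i. i \<in> {1..n} \<Longrightarrow> 0 \<le> c i) \<Longrightarrow> (\<Sum>i=1..n. c i) = 1 \<Longrightarrow>
      (\<And>i. i \<in> {1..n} \<Longrightarrow> f i \<in> Y \<inter> sphere 0 1 \<and> 0 < e i \<and> e i < 1) \<Longrightarrow>
      \<exists>x. (\<forall>i\<in>{1..n}. x i \<in> slice (f i) (e i)) \<and> norm (\<Sum>i=1..n. c i *\<^sub>R x i) = 1"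
  shows "ASD2P Y"
  unfolding ASD2P_def
proof (intro allI impI, elim conjE)
  fix n :: nat and c :: "nat \<Rightarrow> real" and S :: "nat \<Rightarrow> 'a set"
  assume c: "\<forall>i\<in>{1..n}. 0 \<le> c i" "(\<Sum>i=1..n. c i) = 1" and "\<forall>i\<in>{1..n}. S i \<in> slices_by Y"
  then have "\<forall>i\<in>{1..n}. \<exists>f e. S i = slice f e \<and> f \<in> Y \<inter> sphere 0 1 \<and> 0 < e \<and> e < 1"
    by (simp add: slices_by_def)
  then obtain f e where S: "\<And>i. i \<in> {1..n} \<Longrightarrow>
      S i = slice (f i) (e i) \<and> f i \<in> Y \<inter> sphere 0 1 \<and> 0 < e i \<and> e i < 1"
    by metis
  then obtain x where "\<forall>i\<in>{1..n}. x i \<in> slice (f i) (e i)" "norm (\<Sum>i=1..n. c i *\<^sub>R x i) = 1"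
    using assms[of n c f e] c by blast
  then have "(\<Sum>i=1..n. c i *\<^sub>R x i) \<in> set_combination n c S \<inter> sphere 0 1"
    using S by (auto simp: set_combination_def)
  then show "set_combination n c S \<inter> sphere 0 1 \<noteq> {}" by blast
qed

text \<open>An arbitrary finite index set is allowed here, because the combination used for the sum
is indexed by pairs.\<close>

lemma ASD2P_D:
  assumes P: "ASD2P Y" and I: "finite I" and c: "\<And>i. i \<in> I \<Longrightarrow> 0 \<le> c i" "sum c I = 1"
    and f: "\<And>i. i \<in> I \<Longrightarrow> f i \<in> Y \<inter> sphere 0 1" and e: "\<And>i. i \<in> I \<Longrightarrow> 0 < e i \<and> e i < 1"
  obtains x where "\<And>i. i \<in> I \<Longrightarrow> x i \<in> slice (f i) (e i)" "norm (\<Sum>i\<in>I. c i *\<^sub>R x i) = 1"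
proof -
  obtain b where b: "bij_betw b {1..card I} I"
    using ex_bij_betw_nat_finite_1[OF I] ..
  have bI: "b k \<in> I" if "k \<in> {1..card I}" for k
    using b that by (rule bij_betw_apply)
  have "set_combination (card I) (c \<circ> b) (\<lambda>k. slice (f (b k)) (e (b k))) \<inter> sphere 0 1 \<noteq> {}"
  proof (rule P[unfolded ASD2P_def, rule_format], intro conjI ballI)
    show "(\<Sum>k=1..card I. (c \<circ> b) k) = 1"
      using sum.reindex_bij_betw[OF b, of c] c(2) by simp
    show "slice (f (b k)) (e (b k)) \<in> slices_by Y" if "k \<in> {1..card I}" for k
      using f[OF bI[OF that]] e[OF bI[OF that]] unfolding slices_by_def by blast
  qed (use c(1) bI in simp)
  then obtain x where x: "\<forall>k\<in>{1..card I}. x k \<in> slice (f (b k)) (e (b k))"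
    "norm (\<Sum>k=1..card I. c (b k) *\<^sub>R x k) = 1"
    by (auto simp: set_combination_def)
  define a where "a = the_inv_into {1..card I} b"
  have ab: "a (b k) = k" if "k \<in> {1..card I}" for k
    using b that by (simp add: a_def bij_betw_def the_inv_into_f_f)
  have "x (a i) \<in> slice (f i) (e i)" if "i \<in> I" for i
  proof -
    obtain k where "k \<in> {1..card I}" "i = b k"
      using b \<open>i \<in> I\<close> unfolding bij_betw_def by blast
    with x(1) ab show ?thesis by simp
  qed
  moreover have "(\<Sum>i\<in>I. c i *\<^sub>R x (a i)) = (\<Sum>k=1..card I. c (b k) *\<^sub>R x k)"
    using sum.reindex_bij_betw[OF b, of "\<lambda>i. c i *\<^sub>R x (a i)"] ab by simp
  ultimately show ?thesis
    using that[of "\<lambda>i. x (a i)"] x(2) by simp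
qed

lemma norm_convex_combination_le:
  fixes x :: "'i \<Rightarrow> 'a::real_normed_vector"
  assumes "\<And>i. i \<in> I \<Longrightarrow> 0 \<le> c i" "sum c I = 1" "\<And>i. i \<in> I \<Longrightarrow> norm (x i) \<le> 1"
  shows "norm (\<Sum>i\<in>I. c i *\<^sub>R x i) \<le> 1"
proof -
  have "norm (\<Sum>i\<in>I. c i *\<^sub>R x i) \<le> (\<Sum>i\<in>I. norm (c i *\<^sub>R x i))"
    by (rule norm_sum)
  also have "\<dots> \<le> (\<Sum>i\<in>I. c i)"
    using assms(1,3) by (intro sum_mono) (simp add: mult_left_le)
  finally show ?thesis using assms(2) by simp
qed

text \<open>The second coordinate of the combination is in the unit ball, so a first coordinate of norm one
decides the maximum norm.\<close>

lemma (in linf_decomposition) ASD2P_sum: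
  assumes "subspace Y1" and P: "ASD2P Y1"
  shows "ASD2P (Dsum Y1 Y2)"
proof (rule ASD2P_I)
  fix n :: nat and c :: "nat \<Rightarrow> real" and h and e :: "nat \<Rightarrow> real"
  assume c: "\<And>i. i \<in> {1..n} \<Longrightarrow> 0 \<le> c i" "(\<Sum>i=1..n. c i) = 1"
    and h: "\<And>i. i \<in> {1..n} \<Longrightarrow> h i \<in> Dsum Y1 Y2 \<inter> sphere 0 1 \<and> 0 < e i \<and> e i < 1"
  have "\<forall>i\<in>{1..n}. \<exists>f g. f \<in> Y1 \<and> h i = D f g"
    using h by (fastforce simp: Dsum_def)
  then obtain F G where FG: "\<And>i. i \<in> {1..n} \<Longrightarrow> F i \<in> Y1 \<and> h i = D (F i) (G i)"
    by metis
  have "\<exists>x. (\<forall>i\<in>{1..n}. norm (x i) \<le> 1 \<and> (1 - e i) * norm (F i) \<le> F i (x i)) \<and>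
      norm (\<Sum>i=1..n. c i *\<^sub>R x i) = 1"
  \<comment> \<open>Where \<open>F i = 0\<close> any slice will do, provided that \<open>Y1\<close> defines one; if it does not, all
     conditions on \<open>x\<close> are void and a constant family suffices.\<close>
  proof (cases "Y1 \<subseteq> {0}")
    case True
    then have "F i = 0" if "i \<in> {1..n}" for i
      using FG[OF that] by blast
    moreover obtain x :: 'a where "norm x = 1"
      using ex_unit_vector[OF nontrivial1] .
    ultimately show ?thesis
      using c(2) by (intro exI[of _ "\<lambda>_. x"]) (simp add: scaleR_left.sum[symmetric])
  next
    case False
    then obtain f0 where f0: "f0 \<in> Y1" "f0 \<noteq> 0" by blast
    define F' where "F' i = sgn (if F i = 0 then f0 else F i)" for i
    have "F' i \<in> Y1 \<inter> sphere 0 1" if "i \<in> {1..n}" for i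
      using FG[OF that] f0 assms(1) by (auto simp: F'_def sgn_in_subspace norm_sgn)
    then obtain x where x: "\<And>i. i \<in> {1..n} \<Longrightarrow> x i \<in> slice (F' i) (e i)"
      "norm (\<Sum>i=1..n. c i *\<^sub>R x i) = 1"
      using ASD2P_D[OF P, of "{1..n}" c F' e] c h by auto
    have "(1 - e i) * norm (F i) \<le> F i (x i)" if "i \<in> {1..n}" for i
      using x(1)[OF that]
      by (cases "F i = 0") (simp_all add: slice_iff F'_def sgn_blinfun_apply field_simps)
    with x show ?thesis
      by (intro exI[of _ x]) (auto simp: slice_iff)
  qed
  then obtain x where x: "\<And>i. i \<in> {1..n} \<Longrightarrow> norm (x i) \<le> 1 \<and> (1 - e i) * norm (F i) \<le> F i (x i)"
    "norm (\<Sum>i=1..n. c i *\<^sub>R x i) = 1" by blast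
  have "\<forall>i\<in>{1..n}. \<exists>y. norm y = 1 \<and> (1 - e i) * norm (G i) \<le> G i y"
  proof
    fix i assume "i \<in> {1..n}"
    then have "1 - e i < 1" using h by simp
    then show "\<exists>y. norm y = 1 \<and> (1 - e i) * norm (G i) \<le> G i y"
      using ex_almost_norming_vector[OF nontrivial2] by blast
  qed
  then obtain y where y: "\<And>i. i \<in> {1..n} \<Longrightarrow> norm (y i) = 1 \<and> (1 - e i) * norm (G i) \<le> G i (y i)"
    by metis
  have "J (x i) (y i) \<in> slice (h i) (e i)" if i: "i \<in> {1..n}" for i
  proof -
    have "norm (F i) + norm (G i) = 1"
      using h[OF i] FG[OF i] norm_D[of "F i" "G i"] by simp
    then have "1 - e i = (1 - e i) * norm (F i) + (1 - e i) * norm (G i)"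
      by (simp flip: distrib_left)
    then show ?thesis
      using x(1)[OF i] y[OF i] FG[OF i] by (simp add: slice_iff norm_J)
  qed
  moreover have "norm (\<Sum>i=1..n. c i *\<^sub>R J (x i) (y i)) = 1"
    using norm_convex_combination_le[of "{1..n}" c y] c y x(2) by (simp add: norm_J flip: J_sum)
  ultimately show "\<exists>z. (\<forall>i\<in>{1..n}. z i \<in> slice (h i) (e i)) \<and> norm (\<Sum>i=1..n. c i *\<^sub>R z i) = 1"
    by (intro exI[of _ "\<lambda>i. J (x i) (y i)"]) simp
qed

text \<open>Convex combinations of points of the unit ball have norm at most one, so missing the sphere means
lying in the open ball. This strict form can be compared in the maximum norm.\<close>

lemma not_ASD2P_E:
  assumes "\<not> ASD2P Y"
  obtains n :: nat and c f e where "(\<Sum>i=1..n. c i) = 1"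
    "\<forall>i\<in>{1..n}. 0 \<le> c i \<and> f i \<in> Y \<inter> sphere 0 1 \<and> 0 < e i \<and> e i < 1"
    "\<forall>x. (\<forall>i\<in>{1..n}. x i \<in> slice (f i) (e i)) \<longrightarrow> norm (\<Sum>i=1..n. c i *\<^sub>R x i) < 1"
proof (rule ccontr)
  assume *: "\<not> thesis"
  have "ASD2P Y"
  proof (rule ASD2P_I, rule ccontr)
    fix n :: nat and c f e
    assume c: "\<And>i. i \<in> {1..n} \<Longrightarrow> 0 \<le> c i" "(\<Sum>i=1..n. c i) = 1"
      and f: "\<And>i. i \<in> {1..n} \<Longrightarrow> f i \<in> Y \<inter> sphere 0 1 \<and> 0 < e i \<and> e i < 1"
      and none: "\<nexists>x. (\<forall>i\<in>{1..n}. x i \<in> slice (f i) (e i)) \<and> norm (\<Sum>i=1..n. c i *\<^sub>R x i) = 1"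
    have fail: "\<forall>x. (\<forall>i\<in>{1..n}. x i \<in> slice (f i) (e i)) \<longrightarrow> norm (\<Sum>i=1..n. c i *\<^sub>R x i) < 1"
    proof (intro allI impI)
      fix x assume x: "\<forall>i\<in>{1..n}. x i \<in> slice (f i) (e i)"
      have "norm (\<Sum>i=1..n. c i *\<^sub>R x i) \<noteq> 1" using none x by blast
      moreover have "norm (\<Sum>i=1..n. c i *\<^sub>R x i) \<le> 1"
        using x c by (intro norm_convex_combination_le) (auto simp: slice_iff)
      ultimately show "norm (\<Sum>i=1..n. c i *\<^sub>R x i) < 1" by simp
    qed
    have "\<forall>i\<in>{1..n}. 0 \<le> c i \<and> f i \<in> Y \<inter> sphere 0 1 \<and> 0 < e i \<and> e i < 1"
      using c(1) f by blast
    with * that[OF c(2) _ fail] show False by blast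
  qed
  with assms show False by contradiction
qed

lemma halves_in_l1_sum:
  assumes "subspace Y1" "subspace Y2" "f \<in> Y1 \<inter> sphere 0 1" "g \<in> Y2 \<inter> sphere 0 1"
  shows "dual_pair ((1/2) *\<^sub>R f) ((1/2) *\<^sub>R g) \<in> l1_sum Y1 Y2 \<inter> sphere 0 1"
  using assms by (auto simp: l1_sum_def norm_dual_pair intro: subspace_scale)

text \<open>The size \<open>min d e / 2\<close> is such that \<open>f x + g y \<ge> 2 - min d e\<close>, where each summand is at most \<open>1\<close>.\<close>

lemma slice_halves:
  assumes z: "z \<in> slice (dual_pair ((1/2) *\<^sub>R f) ((1/2) *\<^sub>R g)) (min d e / 2)"
    and fg: "norm f = 1" "norm g = 1"
  shows "lfst z \<in> slice f d" "lsnd z \<in> slice g e"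
proof -
  have le: "norm (lfst z) \<le> 1" "norm (lsnd z) \<le> 1"
    and ge: "2 - min d e \<le> f (lfst z) + g (lsnd z)"
    using z by (simp_all add: slice_iff norm_linf_sum_def blinfun.scaleR_left)
  have "f (lfst z) \<le> 1" "g (lsnd z) \<le> 1"
    using blinfun_le_norm[OF le(1), of f] blinfun_le_norm[OF le(2), of g] fg by simp_all
  with ge le show "lfst z \<in> slice f d" "lsnd z \<in> slice g e"
    by (simp_all add: slice_iff)
qed

text \<open>The combination with weights \<open>c i * c' j\<close> is, in its first coordinate, the combination with weights
\<open>c i\<close> of the averages over \<open>j\<close>, which remain in the \<open>i\<close>-th slice by convexity; in its second
coordinate the roles are exchanged.\<close>

lemma ASD2P_summand:
  assumes Y: "subspace Y1" "subspace Y2" and P: "ASD2P (l1_sum Y1 Y2)"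
  shows "ASD2P Y1 \<or> ASD2P Y2"
proof (rule ccontr)
  assume "\<not> ?thesis"
  then have neg: "\<not> ASD2P Y1" "\<not> ASD2P Y2" by simp_all
  obtain n :: nat and c f e where c1: "(\<Sum>i=1..n. c i) = 1"
    and cfe: "\<forall>i\<in>{1..n}. 0 \<le> c i \<and> f i \<in> Y1 \<inter> sphere 0 1 \<and> 0 < e i \<and> e i < 1"
    and fail1: "\<forall>x. (\<forall>i\<in>{1..n}. x i \<in> slice (f i) (e i)) \<longrightarrow>
        norm (\<Sum>i=1..n. c i *\<^sub>R x i) < 1"
    using not_ASD2P_E[OF neg(1)] .
  obtain m :: nat and c' g e' where c1': "(\<Sum>j=1..m. c' j) = 1"
    and cge: "\<forall>j\<in>{1..m}. 0 \<le> c' j \<and> g j \<in> Y2 \<inter> sphere 0 1 \<and> 0 < e' j \<and> e' j < 1"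
    and fail2: "\<forall>y. (\<forall>j\<in>{1..m}. y j \<in> slice (g j) (e' j)) \<longrightarrow>
        norm (\<Sum>j=1..m. c' j *\<^sub>R y j) < 1"
    using not_ASD2P_E[OF neg(2)] .
  have c: "0 \<le> c i" and f: "f i \<in> Y1 \<inter> sphere 0 1" and e: "0 < e i \<and> e i < 1"
    if "i \<in> {1..n}" for i
    using cfe that by blast+
  have c': "0 \<le> c' j" and g: "g j \<in> Y2 \<inter> sphere 0 1" and e': "0 < e' j \<and> e' j < 1"
    if "j \<in> {1..m}" for j
    using cge that by blast+
  obtain z where z: "\<And>i j. i \<in> {1..n} \<Longrightarrow> j \<in> {1..m} \<Longrightarrow>
      z (i, j) \<in> slice (dual_pair ((1/2) *\<^sub>R f i) ((1/2) *\<^sub>R g j)) (min (e i) (e' j) / 2)"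
    and norm_z: "norm (\<Sum>(i, j)\<in>{1..n} \<times> {1..m}. (c i * c' j) *\<^sub>R z (i, j)) = 1"
  proof (rule ASD2P_D[OF P, of "{1..n} \<times> {1..m}" "\<lambda>(i, j). c i * c' j"
      "\<lambda>(i, j). dual_pair ((1/2) *\<^sub>R f i) ((1/2) *\<^sub>R g j)" "\<lambda>(i, j). min (e i) (e' j) / 2"])
    show "(\<Sum>(i, j)\<in>{1..n} \<times> {1..m}. c i * c' j) = 1"
      using c1 c1' by (simp flip: sum.cartesian_product sum_distrib_left)
    fix p assume "p \<in> {1..n} \<times> {1..m}"
    then obtain i j where p: "p = (i, j)" and ij: "i \<in> {1..n}" "j \<in> {1..m}" by blast
    show "0 \<le> (case p of (i, j) \<Rightarrow> c i * c' j)"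
      using c[OF ij(1)] c'[OF ij(2)] by (simp add: p)
    show "(case p of (i, j) \<Rightarrow> dual_pair ((1/2) *\<^sub>R f i) ((1/2) *\<^sub>R g j)) \<in> l1_sum Y1 Y2 \<inter> sphere 0 1"
      using halves_in_l1_sum[OF Y f[OF ij(1)] g[OF ij(2)]] by (simp add: p)
    show "0 < (case p of (i, j) \<Rightarrow> min (e i) (e' j) / 2) \<and>
        (case p of (i, j) \<Rightarrow> min (e i) (e' j) / 2) < 1"
      using e[OF ij(1)] e'[OF ij(2)] by (auto simp: p min_def)
  next
    fix z assume "\<And>p. p \<in> {1..n} \<times> {1..m} \<Longrightarrow>
        z p \<in> slice (case p of (i, j) \<Rightarrow> dual_pair ((1/2) *\<^sub>R f i) ((1/2) *\<^sub>R g j))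
          (case p of (i, j) \<Rightarrow> min (e i) (e' j) / 2)"
      and "norm (\<Sum>p\<in>{1..n} \<times> {1..m}. (case p of (i, j) \<Rightarrow> c i * c' j) *\<^sub>R z p) = 1"
    then show thesis
      by (intro that[of z]) (force, simp add: case_prod_unfold)
  qed simp
  define Z where "Z = (\<Sum>(i, j)\<in>{1..n} \<times> {1..m}. (c i * c' j) *\<^sub>R z (i, j))"
  have "lfst Z = (\<Sum>i=1..n. c i *\<^sub>R (\<Sum>j=1..m. c' j *\<^sub>R lfst (z (i, j))))"
    by (simp add: Z_def linear_sum[OF bounded_linear.linear[OF bounded_linear_lfst]]
        case_prod_unfold scaleR_sum_right sum.cartesian_product)
  moreover have "norm (\<Sum>i=1..n. c i *\<^sub>R (\<Sum>j=1..m. c' j *\<^sub>R lfst (z (i, j)))) < 1"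
    using c' c1' slice_halves(1)[OF z] f g by (intro fail1[rule_format] convex_sum convex_slice) auto
  moreover have "lsnd Z = (\<Sum>j=1..m. c' j *\<^sub>R (\<Sum>i=1..n. c i *\<^sub>R lsnd (z (i, j))))"
  proof -
    have "lsnd Z = (\<Sum>i=1..n. \<Sum>j=1..m. (c i * c' j) *\<^sub>R lsnd (z (i, j)))"
      by (simp add: Z_def linear_sum[OF bounded_linear.linear[OF bounded_linear_lsnd]]
          case_prod_unfold sum.cartesian_product)
    also have "\<dots> = (\<Sum>j=1..m. \<Sum>i=1..n. (c i * c' j) *\<^sub>R lsnd (z (i, j)))"
      by (rule sum.swap)
    finally show ?thesis by (simp add: scaleR_sum_right mult.commute)
  qed
  moreover have "norm (\<Sum>j=1..m. c' j *\<^sub>R (\<Sum>i=1..n. c i *\<^sub>R lsnd (z (i, j)))) < 1"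
    using c c1 slice_halves(2)[OF z] f g by (intro fail2[rule_format] convex_sum convex_slice) auto
  moreover have "norm Z = 1"
    using norm_z by (simp only: Z_def)
  ultimately show False
    by (auto simp: norm_linf_sum_def max_def split: if_splits)
qed

section \<open>Norming properties of the \<open>\<ell>\<^sub>\<infinity>\<close>-sum\<close>

lemma linf_decomposition_LPair:
  assumes "(UNIV :: 'a::real_normed_vector set) \<noteq> {0}" "(UNIV :: 'b::real_normed_vector set) \<noteq> {0}"
  shows "linf_decomposition (LPair :: 'a \<Rightarrow> 'b \<Rightarrow> _) dual_pair"
    and "linf_decomposition (\<lambda>(y :: 'b) (x :: 'a). LPair x y) (\<lambda>g f. dual_pair f g)"
proof -
  have "\<exists>x y. z = LPair x y" for z :: "('a, 'b) linf_sum" by (cases z) blast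
  then show "linf_decomposition (LPair :: 'a \<Rightarrow> 'b \<Rightarrow> _) dual_pair"
    "linf_decomposition (\<lambda>(y :: 'b) (x :: 'a). LPair x y) (\<lambda>g f. dual_pair f g)"
    using assms
    by (unfold_locales;
      auto simp: norm_LPair norm_dual_pair plus_linf_sum_def scaleR_linf_sum_def max.commute)+
qed

lemma lam_norms_antimono: "lam_norms l B A \<Longrightarrow> l' \<le> l \<Longrightarrow> lam_norms l' B A"
  unfolding lam_norms_def by (meson mult_right_mono norm_ge_zero order_trans)

text \<open>A family witnessing failure is nonempty: the empty family is normed by the empty set, on which
any functional of norm one is large.\<close>

lemma not_SD2P_less_E:
  fixes Y :: "('a::real_normed_vector \<Rightarrow>\<^sub>L real) set"
  assumes "(UNIV :: 'a set) \<noteq> {0}" and "\<not> SD2P_less \<kappa> Y"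
  obtains A l where "A \<subseteq> Y \<inter> sphere 0 1" "|A| <o \<kappa>" "A \<noteq> {}" "0 < l" "l < 1"
    "\<forall>B f. B \<subseteq> sphere 0 1 \<longrightarrow> norm f = 1 \<longrightarrow> lam_norms l B A \<longrightarrow> \<not> (\<forall>x\<in>B. l \<le> blinfun_apply f x)"
proof -
  obtain A l where A: "A \<subseteq> Y \<inter> sphere 0 1" "|A| <o \<kappa>" and l: "l \<in> {0<..<1}"
    and none: "\<not> (\<exists>B\<subseteq>sphere 0 1. \<exists>f\<in>sphere 0 1. lam_norms l B A \<and> (\<forall>x\<in>B. l \<le> blinfun_apply f x))"
    using assms(2) unfolding SD2P_less_def by blast
  have fail: "\<forall>B f. B \<subseteq> sphere 0 1 \<longrightarrow> norm f = 1 \<longrightarrow> lam_norms l B A \<longrightarrow> \<not> (\<forall>x\<in>B. l \<le> blinfun_apply f x)"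
    using none by (metis mem_sphere_0)
  have "A \<noteq> {}"
  proof
    assume "A = {}"
    obtain x :: 'a where "norm x = 1" using ex_unit_vector[OF assms(1)] .
    then obtain f :: "'a \<Rightarrow>\<^sub>L real" where "norm f = 1" using ex_norming_functional by blast
    with fail[rule_format, of "{}" f] \<open>A = {}\<close> show False by (simp add: lam_norms_def)
  qed
  with A l fail show ?thesis by (intro that[of A l]) simp_all
qed

lemma not_ASD2P1_less_E:
  fixes Y :: "('a::real_normed_vector \<Rightarrow>\<^sub>L real) set"
  assumes "(UNIV :: 'a set) \<noteq> {0}" and "\<not> ASD2P1_less \<kappa> Y"
  obtains A where "A \<subseteq> Y \<inter> sphere 0 1" "|A| <o \<kappa>" "A \<noteq> {}"
    "\<forall>B f. B \<subseteq> sphere 0 1 \<longrightarrow> norm f = 1 \<longrightarrow> norms B A \<longrightarrow> \<not> (\<forall>x\<in>B. blinfun_apply f x = (1::real))"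
proof -
  obtain A where A: "A \<subseteq> Y \<inter> sphere 0 1" "|A| <o \<kappa>"
    and none: "\<not> (\<exists>B\<subseteq>sphere 0 1. \<exists>f\<in>sphere 0 1. norms B A \<and> (\<forall>x\<in>B. blinfun_apply f x = (1::real)))"
    using assms(2) unfolding ASD2P1_less_def by blast
  have fail: "\<forall>B f. B \<subseteq> sphere 0 1 \<longrightarrow> norm f = 1 \<longrightarrow> norms B A \<longrightarrow> \<not> (\<forall>x\<in>B. blinfun_apply f x = (1::real))"
    using none by (metis mem_sphere_0)
  have "A \<noteq> {}"
  proof
    assume "A = {}"
    obtain x :: 'a where "norm x = 1" using ex_unit_vector[OF assms(1)] .
    then obtain f :: "'a \<Rightarrow>\<^sub>L real" where "norm f = 1" using ex_norming_functional by blast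
    with fail[rule_format, of "{}" f] \<open>A = {}\<close> show False by (simp add: norms_def lam_norms_def)
  qed
  with A fail show ?thesis by (intro that[of A]) simp_all
qed

lemma obtain_halves:
  assumes Y: "subspace Y1" "subspace Y2" and \<kappa>: "Card_order \<kappa>" "infinite (Field \<kappa>)"
    and A1: "A1 \<subseteq> Y1 \<inter> sphere 0 1" "|A1| <o \<kappa>" and A2: "A2 \<subseteq> Y2 \<inter> sphere 0 1" "|A2| <o \<kappa>"
  obtains A where "A \<subseteq> l1_sum Y1 Y2 \<inter> sphere 0 1" "|A| <o \<kappa>"
    "\<forall>f\<in>A1. \<forall>g\<in>A2. dual_pair ((1/2) *\<^sub>R f) ((1/2) *\<^sub>R g) \<in> A"
proof
  let ?A = "(\<lambda>(f, g). dual_pair ((1/2) *\<^sub>R f) ((1/2) *\<^sub>R g)) ` (A1 \<times> A2)"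
  show "?A \<subseteq> l1_sum Y1 Y2 \<inter> sphere 0 1"
  proof (rule image_subsetI, clarify)
    fix f g assume "f \<in> A1" "g \<in> A2"
    then have "f \<in> Y1 \<inter> sphere 0 1" "g \<in> Y2 \<inter> sphere 0 1" using A1(1) A2(1) by blast+
    then show "dual_pair ((1/2) *\<^sub>R f) ((1/2) *\<^sub>R g) \<in> l1_sum Y1 Y2 \<inter> sphere 0 1"
      by (rule halves_in_l1_sum[OF Y])
  qed
  show "|?A| <o \<kappa>"
    by (rule ordLeq_ordLess_trans[OF card_of_image card_of_Times_ordLess[OF \<kappa> A1(2) A2(2)]])
  show "\<forall>f\<in>A1. \<forall>g\<in>A2. dual_pair ((1/2) *\<^sub>R f) ((1/2) *\<^sub>R g) \<in> ?A"
  proof (intro ballI)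
    fix f g assume "f \<in> A1" "g \<in> A2"
    then show "dual_pair ((1/2) *\<^sub>R f) ((1/2) *\<^sub>R g) \<in> ?A"
      by (intro image_eqI[of _ _ "(f, g)"]) simp_all
  qed
qed

text \<open>The two witnesses of failure may come with different constants. The larger one, \<open>l\<close>, serves for
both, and the sum is tested with \<open>(1 + l) / 2\<close> in order to retain \<open>l\<close> in the components.\<close>

lemma SD2P_less_summand:
  fixes Y1 :: "('a::real_normed_vector \<Rightarrow>\<^sub>L real) set"
    and Y2 :: "('b::real_normed_vector \<Rightarrow>\<^sub>L real) set"
  assumes nontrivial: "(UNIV :: 'a set) \<noteq> {0}" "(UNIV :: 'b set) \<noteq> {0}"
    and Y: "subspace Y1" "subspace Y2" and \<kappa>: "Card_order \<kappa>" "infinite (Field \<kappa>)"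
    and P: "SD2P_less \<kappa> (l1_sum Y1 Y2)"
  shows "SD2P_less \<kappa> Y1 \<or> SD2P_less \<kappa> Y2"
proof (rule ccontr)
  interpret L: linf_decomposition "LPair :: 'a \<Rightarrow> 'b \<Rightarrow> _" dual_pair
    by (rule linf_decomposition_LPair[OF nontrivial])
  interpret R: linf_decomposition "\<lambda>(y :: 'b) (x :: 'a). LPair x y" "\<lambda>g f. dual_pair f g"
    by (rule linf_decomposition_LPair[OF nontrivial])
  assume "\<not> ?thesis"
  then have neg: "\<not> SD2P_less \<kappa> Y1" "\<not> SD2P_less \<kappa> Y2" by simp_all
  obtain A1 l1 where A1: "A1 \<subseteq> Y1 \<inter> sphere 0 1" "|A1| <o \<kappa>" "A1 \<noteq> {}" and l1: "0 < l1" "l1 < 1"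
    and fail1: "\<forall>B f. B \<subseteq> sphere 0 1 \<longrightarrow> norm f = 1 \<longrightarrow> lam_norms l1 B A1 \<longrightarrow>
      \<not> (\<forall>x\<in>B. l1 \<le> blinfun_apply f x)"
    using not_SD2P_less_E[OF nontrivial(1) neg(1)] by metis
  obtain A2 l2 where A2: "A2 \<subseteq> Y2 \<inter> sphere 0 1" "|A2| <o \<kappa>" "A2 \<noteq> {}" and l2: "0 < l2" "l2 < 1"
    and fail2: "\<forall>B f. B \<subseteq> sphere 0 1 \<longrightarrow> norm f = 1 \<longrightarrow> lam_norms l2 B A2 \<longrightarrow>
      \<not> (\<forall>x\<in>B. l2 \<le> blinfun_apply f x)"
    using not_SD2P_less_E[OF nontrivial(2) neg(2)] by metis
  obtain A where A: "A \<subseteq> l1_sum Y1 Y2 \<inter> sphere 0 1" "|A| <o \<kappa>"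
    and halves: "\<forall>f\<in>A1. \<forall>g\<in>A2. dual_pair ((1/2) *\<^sub>R f) ((1/2) *\<^sub>R g) \<in> A"
    using obtain_halves[OF Y \<kappa> A1(1,2) A2(1,2)] .
  define l where "l = max l1 l2"
  have l: "0 < l" "l \<le> 1" "l1 \<le> l" "l2 \<le> l" "(1 + l) / 2 \<in> {0<..<1}"
    using l1 l2 by (auto simp: l_def)
  obtain B h where B: "B \<subseteq> sphere 0 1" and h: "h \<in> sphere 0 1"
    and norming: "lam_norms ((1 + l) / 2) B A" and large: "\<forall>z\<in>B. (1 + l) / 2 \<le> blinfun_apply h z"
    using P[unfolded SD2P_less_def, rule_format, OF A l(5)] by blast
  obtain f g where fg: "h = dual_pair f g"
    using dual_pair_surj by blast
  with h have norm_fg: "norm f + norm g = 1" by (simp add: norm_dual_pair)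
  have spheres: "A \<subseteq> sphere 0 1" "A1 \<subseteq> sphere 0 1" "A2 \<subseteq> sphere 0 1"
    using A(1) A1(1) A2(1) by auto
  consider "1 / 2 \<le> norm f" | "1 / 2 \<le> norm g" using norm_fg by linarith
  then show False
  proof cases
    case 1
    show False
    proof (rule notE[OF fail1[rule_format]])
      show "L.fst_dirs B \<subseteq> sphere 0 1" by (rule L.fst_dirs_subset_sphere)
      show "norm (sgn f) = 1" using 1 by (auto simp: norm_sgn)
      show "lam_norms l1 (L.fst_dirs B) A1"
      proof (rule lam_norms_antimono[OF L.lam_norms_fst_dirs[OF l(1) B norming spheres(1,2)] l(3)])
        show "\<exists>g. norm g \<le> 1 \<and> dual_pair ((1/2) *\<^sub>R f) ((1/2) *\<^sub>R g) \<in> A" if "f \<in> A1" for f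
          using halves[rule_format, OF that] A2(3) spheres(3) by fastforce
      qed
      show "\<forall>x\<in>L.fst_dirs B. l1 \<le> sgn f x"
        using L.large_on_fst_dirs[OF l(1,2) B, where f = f and g = g] h large 1 l(3) by (fastforce simp: fg)
    qed
  next
    case 2
    show False
    proof (rule notE[OF fail2[rule_format]])
      show "R.fst_dirs B \<subseteq> sphere 0 1" by (rule R.fst_dirs_subset_sphere)
      show "norm (sgn g) = 1" using 2 by (auto simp: norm_sgn)
      show "lam_norms l2 (R.fst_dirs B) A2"
      proof (rule lam_norms_antimono[OF R.lam_norms_fst_dirs[OF l(1) B norming spheres(1,3)] l(4)])
        show "\<exists>f. norm f \<le> 1 \<and> dual_pair ((1/2) *\<^sub>R f) ((1/2) *\<^sub>R g) \<in> A" if "g \<in> A2" for g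
          using halves[rule_format, OF _ that] A1(3) spheres(2) by fastforce
      qed
      show "\<forall>x\<in>R.fst_dirs B. l2 \<le> sgn g x"
        using R.large_on_fst_dirs[OF l(1,2) B, where f = g and g = f] h large 2 l(4) by (fastforce simp: fg)
    qed
  qed
qed

lemma ASD2P1_less_summand:
  fixes Y1 :: "('a::real_normed_vector \<Rightarrow>\<^sub>L real) set"
    and Y2 :: "('b::real_normed_vector \<Rightarrow>\<^sub>L real) set"
  assumes nontrivial: "(UNIV :: 'a set) \<noteq> {0}" "(UNIV :: 'b set) \<noteq> {0}"
    and Y: "subspace Y1" "subspace Y2" and \<kappa>: "Card_order \<kappa>" "infinite (Field \<kappa>)"
    and P: "ASD2P1_less \<kappa> (l1_sum Y1 Y2)"
  shows "ASD2P1_less \<kappa> Y1 \<or> ASD2P1_less \<kappa> Y2"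
proof (rule ccontr)
  interpret L: linf_decomposition "LPair :: 'a \<Rightarrow> 'b \<Rightarrow> _" dual_pair
    by (rule linf_decomposition_LPair[OF nontrivial])
  interpret R: linf_decomposition "\<lambda>(y :: 'b) (x :: 'a). LPair x y" "\<lambda>g f. dual_pair f g"
    by (rule linf_decomposition_LPair[OF nontrivial])
  assume "\<not> ?thesis"
  then have neg: "\<not> ASD2P1_less \<kappa> Y1" "\<not> ASD2P1_less \<kappa> Y2" by simp_all
  obtain A1 where A1: "A1 \<subseteq> Y1 \<inter> sphere 0 1" "|A1| <o \<kappa>" "A1 \<noteq> {}"
    and fail1: "\<forall>B f. B \<subseteq> sphere 0 1 \<longrightarrow> norm f = 1 \<longrightarrow> norms B A1 \<longrightarrow>
      \<not> (\<forall>x\<in>B. blinfun_apply f x = (1::real))"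
    using not_ASD2P1_less_E[OF nontrivial(1) neg(1)] by metis
  obtain A2 where A2: "A2 \<subseteq> Y2 \<inter> sphere 0 1" "|A2| <o \<kappa>" "A2 \<noteq> {}"
    and fail2: "\<forall>B f. B \<subseteq> sphere 0 1 \<longrightarrow> norm f = 1 \<longrightarrow> norms B A2 \<longrightarrow>
      \<not> (\<forall>x\<in>B. blinfun_apply f x = (1::real))"
    using not_ASD2P1_less_E[OF nontrivial(2) neg(2)] by metis
  obtain A where A: "A \<subseteq> l1_sum Y1 Y2 \<inter> sphere 0 1" "|A| <o \<kappa>"
    and halves: "\<forall>f\<in>A1. \<forall>g\<in>A2. dual_pair ((1/2) *\<^sub>R f) ((1/2) *\<^sub>R g) \<in> A"
    using obtain_halves[OF Y \<kappa> A1(1,2) A2(1,2)] .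
  obtain B h where B: "B \<subseteq> sphere 0 1" and h: "h \<in> sphere 0 1"
    and norming: "norms B A" and one: "\<forall>z\<in>B. blinfun_apply h z = (1::real)"
    using P[unfolded ASD2P1_less_def, rule_format, OF A] by blast
  obtain f g where fg: "h = dual_pair f g"
    using dual_pair_surj by blast
  with h have norm_fg: "norm f + norm g = 1" by (simp add: norm_dual_pair)
  have spheres: "A \<subseteq> sphere 0 1" "A1 \<subseteq> sphere 0 1" "A2 \<subseteq> sphere 0 1"
    using A(1) A1(1) A2(1) by auto
  consider "1 / 2 \<le> norm f" | "1 / 2 \<le> norm g" using norm_fg by linarith
  then show False
  proof cases
    case 1
    show False
    proof (rule notE[OF fail1[rule_format]])
      show "L.fst_dirs B \<subseteq> sphere 0 1" by (rule L.fst_dirs_subset_sphere)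
      show "norm (sgn f) = 1" using 1 by (auto simp: norm_sgn)
      show "norms (L.fst_dirs B) A1"
      proof (rule L.norms_fst_dirs[OF B norming spheres(1,2)])
        show "\<exists>g. norm g \<le> 1 \<and> dual_pair ((1/2) *\<^sub>R f) ((1/2) *\<^sub>R g) \<in> A" if "f \<in> A1" for f
          using halves[rule_format, OF that] A2(3) spheres(3) by fastforce
      qed
      show "\<forall>x\<in>L.fst_dirs B. sgn f x = 1"
        using L.one_on_fst_dirs[OF B, where f = f and g = g] h one 1 by (simp add: fg)
    qed
  next
    case 2
    show False
    proof (rule notE[OF fail2[rule_format]])
      show "R.fst_dirs B \<subseteq> sphere 0 1" by (rule R.fst_dirs_subset_sphere)
      show "norm (sgn g) = 1" using 2 by (auto simp: norm_sgn)
      show "norms (R.fst_dirs B) A2"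
      proof (rule R.norms_fst_dirs[OF B norming spheres(1,3)])
        show "\<exists>f. norm f \<le> 1 \<and> dual_pair ((1/2) *\<^sub>R f) ((1/2) *\<^sub>R g) \<in> A" if "g \<in> A2" for g
          using halves[rule_format, OF _ that] A1(3) spheres(2) by fastforce
      qed
      show "\<forall>x\<in>R.fst_dirs B. sgn g x = 1"
        using R.one_on_fst_dirs[OF B, where f = g and g = f] h one 2 by (simp add: fg)
    qed
  qed
qed

theorem proposition4p6:
  fixes Y1 :: "('a::real_normed_vector \<Rightarrow>\<^sub>L real) set"
    and Y2 :: "('b::real_normed_vector \<Rightarrow>\<^sub>L real) set"
    and \<kappa> :: "'k rel"
  assumes "(UNIV :: 'a set) \<noteq> {0}" and "(UNIV :: 'b set) \<noteq> {0}"
    and "subspace Y1" and "subspace Y2"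
    and "Card_order \<kappa>" and "infinite (Field \<kappa>)"
  shows "((SD2P_less \<kappa> Y1 \<or> SD2P_less \<kappa> Y2) \<longleftrightarrow> SD2P_less \<kappa> (l1_sum Y1 Y2))
    \<and> ((ASD2P1_less \<kappa> Y1 \<or> ASD2P1_less \<kappa> Y2) \<longleftrightarrow> ASD2P1_less \<kappa> (l1_sum Y1 Y2))
    \<and> ((ASD2P Y1 \<or> ASD2P Y2) \<longleftrightarrow> ASD2P (l1_sum Y1 Y2))"
proof -
  interpret L: linf_decomposition "LPair :: 'a \<Rightarrow> 'b \<Rightarrow> _" dual_pair
    by (rule linf_decomposition_LPair[OF assms(1,2)])
  interpret R: linf_decomposition "\<lambda>(y :: 'b) (x :: 'a). LPair x y" "\<lambda>g f. dual_pair f g"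
    by (rule linf_decomposition_LPair[OF assms(1,2)])
  have Dsum: "L.Dsum Y1 Y2 = l1_sum Y1 Y2" "R.Dsum Y2 Y1 = l1_sum Y1 Y2"
    unfolding L.Dsum_def R.Dsum_def l1_sum_def by blast+
  have "SD2P_less \<kappa> Y1 \<or> SD2P_less \<kappa> Y2 \<longleftrightarrow> SD2P_less \<kappa> (l1_sum Y1 Y2)"
    using L.SD2P_less_sum[OF assms(3), where ?Y2.0 = Y2]
      R.SD2P_less_sum[OF assms(4), where ?Y2.0 = Y1]
      SD2P_less_summand[OF assms] unfolding Dsum by blast
  moreover have "ASD2P1_less \<kappa> Y1 \<or> ASD2P1_less \<kappa> Y2 \<longleftrightarrow> ASD2P1_less \<kappa> (l1_sum Y1 Y2)"
    using L.ASD2P1_less_sum[OF assms(3), where ?Y2.0 = Y2]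
      R.ASD2P1_less_sum[OF assms(4), where ?Y2.0 = Y1]
      ASD2P1_less_summand[OF assms] unfolding Dsum by blast
  moreover have "ASD2P Y1 \<or> ASD2P Y2 \<longleftrightarrow> ASD2P (l1_sum Y1 Y2)"
    using L.ASD2P_sum[OF assms(3), where ?Y2.0 = Y2]
      R.ASD2P_sum[OF assms(4), where ?Y2.0 = Y1]
      ASD2P_summand[OF assms(3,4)] unfolding Dsum by blast
  ultimately show ?thesis by blast
qed

end
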